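(* Let $X$ be a real Banach space. Then $d_{BM}(\mathcal{F}(X),\mathcal{F}(X)\oplus_1 \mathcal{F}(X))\leq 4$.
   Context: For a pointed metric space $(M,d,0)$, $Lip_0(M)$ is the Banach space of all real-valued Lipschitz functions $f$ on $M$ with $f(0)=0$, with norm $\|f\|_{Lip}=\sup_{x\ne y}\frac{|f(x)-f(y)|}{d(x,y)}$. The Lipschitz-free space $\mathcal{F}(M)$ is the norm closure in $Lip_0(M)^*$ of the linear span of the evaluation functionals $\delta_x: f\mapsto f(x)$, $x\in M$. Different choices of base point give isometrically isomorphic spaces. A Banach space is regarded as a metric space with its norm distance. $Y\oplus_1 Z$ is the direct sum with norm $\|y\|+\|z\|$. For isomorphic Banach spaces $Y,Z$, the Banach-Mazur distance is $d_{BM}(Y,Z)=\inf\{\|T\|\cdot\|T^{-1}\|: T \text{ is a linear isomorphism from } Y \text{ onto } Z\}$. *)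

theory Defs
  imports "HOL-Analysis.Analysis"
begin

section \<open>The space of Lipschitz functions vanishing at the base point\<close>

text \<open>A pointed metric space is a type of sort \<open>{metric_space, zero}\<close>, with base point \<open>0\<close>. No axiom
  relates the constant \<open>0\<close> to the metric, so for a general type of this sort it is an arbitrary point;
  for a normed space it is the origin.\<close>

typedef (overloaded) ('a::"{metric_space, zero}") lip0 =
  "{f :: 'a \<Rightarrow> real. (\<exists>C. C-lipschitz_on UNIV f) \<and> f 0 = 0}"
  morphisms lip0_apply Lip0
  by (rule exI[of _ "\<lambda>_. 0"]) (auto intro!: exI[of _ 0] lipschitz_onI)

setup_lifting type_definition_lip0

lemma lip0_eqI: "(\<And>x. lip0_apply f x = lip0_apply g x) \<Longrightarrow> f = g"
  by transfer auto

lemma lip0_apply_0 [simp]: "lip0_apply f 0 = 0"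
  by transfer simp

instantiation lip0 :: ("{metric_space, zero}") real_vector
begin

lift_definition zero_lip0 :: "'a lip0" is "\<lambda>_. 0"
  by (auto intro!: exI[of _ 0] lipschitz_onI)

lift_definition plus_lip0 :: "'a lip0 \<Rightarrow> 'a lip0 \<Rightarrow> 'a lip0" is "\<lambda>f g x. f x + g x"
  by (auto intro: lipschitz_on_add)

lift_definition uminus_lip0 :: "'a lip0 \<Rightarrow> 'a lip0" is "\<lambda>f x. - f x"
  by (auto intro: lipschitz_on_minus)

lift_definition minus_lip0 :: "'a lip0 \<Rightarrow> 'a lip0 \<Rightarrow> 'a lip0" is "\<lambda>f g x. f x - g x"
  by (auto intro: lipschitz_on_diff)

lift_definition scaleR_lip0 :: "real \<Rightarrow> 'a lip0 \<Rightarrow> 'a lip0" is "\<lambda>c f x. c * f x"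
  by (auto intro: lipschitz_on_cmult_real)

lemmas lip0_apply_simps [simp] =
  zero_lip0.rep_eq plus_lip0.rep_eq uminus_lip0.rep_eq minus_lip0.rep_eq scaleR_lip0.rep_eq

instance
  by standard (auto intro!: lip0_eqI simp: algebra_simps)

end

text \<open>The supremum defining the Lipschitz norm is taken over all pairs \<open>(x, y)\<close>. A diagonal pair
  contributes \<open>0 / 0 = 0\<close>, which leaves the supremum over \<open>x \<noteq> y\<close> unchanged and gives the value \<open>0\<close>
  (rather than the unspecified \<open>Sup {}\<close>) on a one-point space.\<close>

definition lip0_norm :: "'a::{metric_space, zero} lip0 \<Rightarrow> real" where
  "lip0_norm f = (SUP (x, y). \<bar>lip0_apply f x - lip0_apply f y\<bar> / dist x y)"

lemma lip0_norm_bdd: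
  "bdd_above (range (\<lambda>(x, y). \<bar>lip0_apply f x - lip0_apply f y\<bar> / dist x y))"
proof -
  obtain C where C: "C-lipschitz_on UNIV (lip0_apply f)"
    using lip0_apply[of f] by auto
  have "\<bar>lip0_apply f x - lip0_apply f y\<bar> / dist x y \<le> C" for x y
    using lipschitz_onD[OF C, of x y] lipschitz_on_nonneg[OF C]
    by (cases "x = y") (auto simp: dist_real_def divide_le_eq)
  then show ?thesis
    by (auto intro!: bdd_aboveI[of _ C])
qed

lemma lip0_norm_bound:
  "\<bar>lip0_apply f x - lip0_apply f y\<bar> \<le> lip0_norm f * dist x y"
proof (cases "x = y")
  case False
  have "\<bar>lip0_apply f x - lip0_apply f y\<bar> / dist x y \<le> lip0_norm f"
    unfolding lip0_norm_def using cSUP_upper[OF UNIV_I lip0_norm_bdd[of f], of "(x, y)"] by simp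
  with False show ?thesis
    by (simp add: divide_le_eq)
qed simp

lemma lip0_norm_leI:
  assumes "0 \<le> C" "\<And>x y. \<bar>lip0_apply f x - lip0_apply f y\<bar> \<le> C * dist x y"
  shows "lip0_norm f \<le> C"
  unfolding lip0_norm_def
proof (rule cSUP_least)
  fix p :: "'a \<times> 'a"
  obtain x y where "p = (x, y)" by force
  with assms show "(case p of (x, y) \<Rightarrow> \<bar>lip0_apply f x - lip0_apply f y\<bar> / dist x y) \<le> C"
    by (cases "x = y") (auto simp: divide_le_eq)
qed simp

lemma lip0_norm_nonneg: "0 \<le> lip0_norm f"
  using cSUP_upper[OF UNIV_I lip0_norm_bdd[of f], of "(0, 0)"] by (simp add: lip0_norm_def)

lemma lip0_norm_scaleR_le: "lip0_norm (a *\<^sub>R f) \<le> \<bar>a\<bar> * lip0_norm f"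
proof (rule lip0_norm_leI)
  fix x y
  have "\<bar>lip0_apply (a *\<^sub>R f) x - lip0_apply (a *\<^sub>R f) y\<bar>
      = \<bar>a\<bar> * \<bar>lip0_apply f x - lip0_apply f y\<bar>"
    by (simp add: abs_mult flip: right_diff_distrib)
  also have "\<dots> \<le> \<bar>a\<bar> * (lip0_norm f * dist x y)"
    by (intro mult_left_mono lip0_norm_bound) simp
  finally show "\<bar>lip0_apply (a *\<^sub>R f) x - lip0_apply (a *\<^sub>R f) y\<bar> \<le> \<bar>a\<bar> * lip0_norm f * dist x y"
    by (simp add: mult.assoc)
qed (simp add: lip0_norm_nonneg)

instantiation lip0 :: ("{metric_space, zero}") real_normed_vector
begin

definition norm_lip0 :: "'a lip0 \<Rightarrow> real" where
  "norm_lip0 = lip0_norm"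

definition dist_lip0 :: "'a lip0 \<Rightarrow> 'a lip0 \<Rightarrow> real" where
  "dist_lip0 f g = norm (f - g)"

definition sgn_lip0 :: "'a lip0 \<Rightarrow> 'a lip0" where
  "sgn_lip0 f = f /\<^sub>R norm f"

definition uniformity_lip0 :: "('a lip0 \<times> 'a lip0) filter" where
  "uniformity_lip0 = (INF e\<in>{0<..}. principal {(f, g). dist f g < e})"

definition open_lip0 :: "'a lip0 set \<Rightarrow> bool" where
  "open_lip0 S \<longleftrightarrow> (\<forall>f\<in>S. \<forall>\<^sub>F (f', g) in uniformity. f' = f \<longrightarrow> g \<in> S)"

instance
proof
  fix a :: real and f g :: "'a lip0"
  show "norm f = 0 \<longleftrightarrow> f = 0"
  proof
    assume "norm f = 0"
    then have "lip0_apply f x = 0" for x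
      using lip0_norm_bound[of f x 0] by (simp add: norm_lip0_def)
    then show "f = 0"
      by (intro lip0_eqI) simp
  next
    assume "f = 0"
    then have "lip0_norm f \<le> 0"
      by (intro lip0_norm_leI) auto
    then show "norm f = 0"
      using lip0_norm_nonneg[of f] by (simp add: norm_lip0_def)
  qed
  show "norm (f + g) \<le> norm f + norm g"
    unfolding norm_lip0_def
  proof (rule lip0_norm_leI)
    fix x y
    show "\<bar>lip0_apply (f + g) x - lip0_apply (f + g) y\<bar> \<le> (lip0_norm f + lip0_norm g) * dist x y"
      using lip0_norm_bound[of f x y] lip0_norm_bound[of g x y]
      by (simp add: distrib_right)
  qed (simp add: lip0_norm_nonneg)
  show "norm (a *\<^sub>R f) = \<bar>a\<bar> * norm f"
  proof (cases "a = 0")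
    case True
    then show ?thesis
      using lip0_norm_scaleR_le[of a f] lip0_norm_nonneg[of "a *\<^sub>R f"] by (simp add: norm_lip0_def)
  next
    case False
    have "\<bar>a\<bar> * lip0_norm f = \<bar>a\<bar> * lip0_norm (inverse a *\<^sub>R (a *\<^sub>R f))"
      using False by simp
    also have "\<dots> \<le> \<bar>a\<bar> * (\<bar>inverse a\<bar> * lip0_norm (a *\<^sub>R f))"
      by (intro mult_left_mono lip0_norm_scaleR_le) simp
    also have "\<dots> = lip0_norm (a *\<^sub>R f)"
      using False by (simp add: abs_inverse flip: mult.assoc)
    finally show ?thesis
      using lip0_norm_scaleR_le[of a f] by (simp add: norm_lip0_def)
  qed
qed (simp_all add: dist_lip0_def sgn_lip0_def uniformity_lip0_def open_lip0_def)

end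

lemma lip0_apply_bound: "\<bar>lip0_apply f x\<bar> \<le> norm f * dist x 0"
  using lip0_norm_bound[of f x 0] by (simp add: norm_lip0_def)

instance lip0 :: ("{metric_space, zero}") banach
proof
  fix F :: "nat \<Rightarrow> 'a lip0"
  assume F: "Cauchy F"
  have "Cauchy (\<lambda>n. lip0_apply (F n) x)" for x
  proof (rule CauchyI)
    fix e :: real assume "0 < e"
    then have e: "0 < e / (dist x 0 + 1)"
      by (simp add: add_nonneg_pos)
    obtain N where N: "\<And>m n. m \<ge> N \<Longrightarrow> n \<ge> N \<Longrightarrow> norm (F m - F n) < e / (dist x 0 + 1)"
      using CauchyD[OF F e] by blast
    have "norm (lip0_apply (F m) x - lip0_apply (F n) x) < e" if "m \<ge> N" "n \<ge> N" for m n
    proof -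
      have "\<bar>lip0_apply (F m) x - lip0_apply (F n) x\<bar> \<le> norm (F m - F n) * dist x 0"
        using lip0_apply_bound[of "F m - F n" x] by simp
      also have "\<dots> \<le> norm (F m - F n) * (dist x 0 + 1)"
        by (intro mult_left_mono) auto
      also have "\<dots> < e"
        using N[OF that] by (simp add: pos_less_divide_eq add_nonneg_pos)
      finally show ?thesis by simp
    qed
    then show "\<exists>M. \<forall>m\<ge>M. \<forall>n\<ge>M. norm (lip0_apply (F m) x - lip0_apply (F n) x) < e"
      by blast
  qed
  then have "convergent (\<lambda>n. lip0_apply (F n) x)" for x
    by (rule Cauchy_convergent)
  then obtain g where g: "\<And>x. (\<lambda>n. lip0_apply (F n) x) \<longlonglongrightarrow> g x"
    using that[of "\<lambda>x. lim (\<lambda>n. lip0_apply (F n) x)"] by (simp add: convergent_LIMSEQ_iff)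
  have close: "\<exists>N. \<forall>n\<ge>N. \<forall>x y. \<bar>(lip0_apply (F n) x - g x) - (lip0_apply (F n) y - g y)\<bar> \<le> e * dist x y"
    if "0 < e" for e
  proof -
    obtain N where N: "\<And>m n. m \<ge> N \<Longrightarrow> n \<ge> N \<Longrightarrow> norm (F m - F n) < e"
      using CauchyD[OF F \<open>0 < e\<close>] by blast
    have "\<bar>(lip0_apply (F n) x - g x) - (lip0_apply (F n) y - g y)\<bar> \<le> e * dist x y"
      if "n \<ge> N" for n x y
    proof (rule LIMSEQ_le_const2)
      show "(\<lambda>m. \<bar>(lip0_apply (F n) x - lip0_apply (F m) x) - (lip0_apply (F n) y - lip0_apply (F m) y)\<bar>)
          \<longlonglongrightarrow> \<bar>(lip0_apply (F n) x - g x) - (lip0_apply (F n) y - g y)\<bar>"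
        by (intro tendsto_intros g)
      have "\<bar>(lip0_apply (F n) x - lip0_apply (F m) x) - (lip0_apply (F n) y - lip0_apply (F m) y)\<bar>
          \<le> e * dist x y" if "m \<ge> N" for m
      proof -
        have "\<bar>(lip0_apply (F n) x - lip0_apply (F m) x) - (lip0_apply (F n) y - lip0_apply (F m) y)\<bar>
            \<le> norm (F n - F m) * dist x y"
          using lip0_norm_bound[of "F n - F m" x y] by (simp add: norm_lip0_def)
        also have "\<dots> \<le> e * dist x y"
          using N[OF \<open>n \<ge> N\<close> that] by (intro mult_right_mono) auto
        finally show ?thesis .
      qed
      then show "\<exists>M. \<forall>m\<ge>M. \<bar>(lip0_apply (F n) x - lip0_apply (F m) x)
          - (lip0_apply (F n) y - lip0_apply (F m) y)\<bar> \<le> e * dist x y"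
        by blast
    qed
    then show ?thesis by blast
  qed
  obtain N where N: "\<And>x y. \<bar>(lip0_apply (F N) x - g x) - (lip0_apply (F N) y - g y)\<bar> \<le> 1 * dist x y"
    using close[of 1] by auto
  have "(norm (F N) + 1)-lipschitz_on UNIV g"
  proof (rule lipschitz_onI)
    fix x y
    show "dist (g x) (g y) \<le> (norm (F N) + 1) * dist x y"
      using N[of x y] lip0_norm_bound[of "F N" x y]
      by (simp add: norm_lip0_def dist_real_def distrib_right)
  qed simp
  moreover have "g 0 = 0"
    using g[of 0] by (simp add: LIMSEQ_const_iff)
  ultimately have G: "lip0_apply (Lip0 g) = g"
    by (intro Lip0_inverse) auto
  have "F \<longlonglongrightarrow> Lip0 g"
  proof (rule LIMSEQ_I)
    fix e :: real assume "0 < e"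
    then obtain N where N: "\<forall>n\<ge>N. \<forall>x y.
        \<bar>(lip0_apply (F n) x - g x) - (lip0_apply (F n) y - g y)\<bar> \<le> e / 2 * dist x y"
      using close[of "e / 2"] by auto
    have "norm (F n - Lip0 g) < e" if "n \<ge> N" for n
    proof -
      have "norm (F n - Lip0 g) \<le> e / 2"
        unfolding norm_lip0_def using N that \<open>0 < e\<close> by (intro lip0_norm_leI) (auto simp: G)
      with \<open>0 < e\<close> show ?thesis by simp
    qed
    then show "\<exists>N. \<forall>n\<ge>N. norm (F n - Lip0 g) < e"
      by blast
  qed
  then show "convergent F"
    by (rule convergentI)
qed

section \<open>The Lipschitz-free space\<close>

lift_definition lip_delta :: "'a::{metric_space, zero} \<Rightarrow> 'a lip0 \<Rightarrow>\<^sub>L real" is "\<lambda>x f. lip0_apply f x"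
proof -
  fix x :: 'a
  show "bounded_linear (\<lambda>f. lip0_apply f x)"
    by (rule bounded_linear_intro[where K = "dist x 0"]) (auto intro: lip0_apply_bound)
qed

lemma subspace_closure_real_normed:
  fixes S :: "'a::real_normed_vector set"
  assumes "subspace S"
  shows "subspace (closure S)"
  unfolding subspace_def
proof (intro conjI ballI allI)
  show "0 \<in> closure S"
    using subspace_0[OF assms] closure_subset by blast
next
  fix x y assume "x \<in> closure S" "y \<in> closure S"
  then obtain X Y where "\<And>n. X n \<in> S" "X \<longlonglongrightarrow> x" "\<And>n. Y n \<in> S" "Y \<longlonglongrightarrow> y"
    unfolding closure_sequential by blast
  then show "x + y \<in> closure S"
    unfolding closure_sequential
    by (intro exI[of _ "\<lambda>n. X n + Y n"]) (auto intro: tendsto_add subspace_add[OF assms])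
next
  fix c x assume "x \<in> closure S"
  then obtain X where "\<And>n. X n \<in> S" "X \<longlonglongrightarrow> x"
    unfolding closure_sequential by blast
  then show "c *\<^sub>R x \<in> closure S"
    unfolding closure_sequential
    by (intro exI[of _ "\<lambda>n. c *\<^sub>R X n"]) (auto intro: tendsto_scaleR subspace_scale[OF assms])
qed

typedef (overloaded) ('a::"{metric_space, zero}") lip_free =
  "closure (span (range lip_delta)) :: ('a lip0 \<Rightarrow>\<^sub>L real) set"
  morphisms lip_free_functional Lip_free
  using closure_subset[of "span (range lip_delta)"] span_zero by blast

setup_lifting type_definition_lip_free

lemma subspace_lip_free: "subspace (closure (span (range lip_delta)))"
  by (intro subspace_closure_real_normed subspace_span)

instantiation lip_free :: ("{metric_space, zero}") real_vector
begin

lift_definition zero_lip_free :: "'a lip_free" is 0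
  by (rule subspace_0[OF subspace_lip_free])

lift_definition plus_lip_free :: "'a lip_free \<Rightarrow> 'a lip_free \<Rightarrow> 'a lip_free" is "(+)"
  by (rule subspace_add[OF subspace_lip_free])

lift_definition uminus_lip_free :: "'a lip_free \<Rightarrow> 'a lip_free" is uminus
  by (rule subspace_neg[OF subspace_lip_free])

lift_definition minus_lip_free :: "'a lip_free \<Rightarrow> 'a lip_free \<Rightarrow> 'a lip_free" is "(-)"
  by (rule subspace_diff[OF subspace_lip_free])

lift_definition scaleR_lip_free :: "real \<Rightarrow> 'a lip_free \<Rightarrow> 'a lip_free" is "(*\<^sub>R)"
  by (rule subspace_scale[OF subspace_lip_free])

instance
  by standard (transfer; simp add: algebra_simps)+

end

instantiation lip_free :: ("{metric_space, zero}") real_normed_vector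
begin

lift_definition norm_lip_free :: "'a lip_free \<Rightarrow> real" is norm .

definition dist_lip_free :: "'a lip_free \<Rightarrow> 'a lip_free \<Rightarrow> real" where
  "dist_lip_free u v = norm (u - v)"

definition sgn_lip_free :: "'a lip_free \<Rightarrow> 'a lip_free" where
  "sgn_lip_free u = u /\<^sub>R norm u"

definition uniformity_lip_free :: "('a lip_free \<times> 'a lip_free) filter" where
  "uniformity_lip_free = (INF e\<in>{0<..}. principal {(u, v). dist u v < e})"

definition open_lip_free :: "'a lip_free set \<Rightarrow> bool" where
  "open_lip_free S \<longleftrightarrow> (\<forall>u\<in>S. \<forall>\<^sub>F (u', v) in uniformity. u' = u \<longrightarrow> v \<in> S)"

instance
proof
  fix a :: real and u v :: "'a lip_free"
  show "norm (a *\<^sub>R u) = \<bar>a\<bar> * norm u"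
    by transfer simp
  show "norm u = 0 \<longleftrightarrow> u = 0"
    by transfer simp
  show "norm (u + v) \<le> norm u + norm v"
    by transfer (rule norm_triangle_ineq)
qed (simp_all add: dist_lip_free_def sgn_lip_free_def uniformity_lip_free_def open_lip_free_def)

end

instance lip_free :: ("{metric_space, zero}") banach
proof
  fix U :: "nat \<Rightarrow> 'a lip_free"
  assume U: "Cauchy U"
  have d: "dist (lip_free_functional u) (lip_free_functional v) = dist u v" for u v :: "'a lip_free"
    by (simp add: dist_norm norm_lip_free.rep_eq minus_lip_free.rep_eq)
  have "Cauchy (\<lambda>n. lip_free_functional (U n))"
    using U by (simp add: Cauchy_def d)
  then obtain l where l: "(\<lambda>n. lip_free_functional (U n)) \<longlonglongrightarrow> l"
    using Cauchy_convergent_iff convergent_def by blast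
  then have "l \<in> closure (span (range lip_delta))"
    using lip_free_functional by (intro closed_sequentially[OF closed_closure _ l]) auto
  then have "lip_free_functional (Lip_free l) = l"
    by (rule Lip_free_inverse)
  with l have "U \<longlonglongrightarrow> Lip_free l"
    by (simp add: tendsto_iff flip: d)
  then show "convergent U"
    by (rule convergentI)
qed

section \<open>The \<open>\<ell>\<^sub>1\<close>-sum of two normed spaces\<close>

text \<open>A copy of the product type is needed because the library norm on \<open>'a \<times> 'b\<close> is
  \<open>sqrt ((norm x)\<^sup>2 + (norm y)\<^sup>2)\<close>.\<close>

typedef ('a, 'b) l1_sum = "UNIV :: ('a \<times> 'b) set"
  morphisms l1_pair L1_pair
  by simp

setup_lifting type_definition_l1_sum

instantiation l1_sum :: (real_vector, real_vector) real_vector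
begin

lift_definition zero_l1_sum :: "('a, 'b) l1_sum" is 0 .
lift_definition plus_l1_sum :: "('a, 'b) l1_sum \<Rightarrow> ('a, 'b) l1_sum \<Rightarrow> ('a, 'b) l1_sum" is "(+)" .
lift_definition uminus_l1_sum :: "('a, 'b) l1_sum \<Rightarrow> ('a, 'b) l1_sum" is uminus .
lift_definition minus_l1_sum :: "('a, 'b) l1_sum \<Rightarrow> ('a, 'b) l1_sum \<Rightarrow> ('a, 'b) l1_sum" is "(-)" .
lift_definition scaleR_l1_sum :: "real \<Rightarrow> ('a, 'b) l1_sum \<Rightarrow> ('a, 'b) l1_sum" is "(*\<^sub>R)" .

instance
  by standard (transfer; simp add: algebra_simps)+

end

instantiation l1_sum :: (real_normed_vector, real_normed_vector) real_normed_vector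
begin

lift_definition norm_l1_sum :: "('a, 'b) l1_sum \<Rightarrow> real" is "\<lambda>(x, y). norm x + norm y" .

definition dist_l1_sum :: "('a, 'b) l1_sum \<Rightarrow> ('a, 'b) l1_sum \<Rightarrow> real" where
  "dist_l1_sum p q = norm (p - q)"

definition sgn_l1_sum :: "('a, 'b) l1_sum \<Rightarrow> ('a, 'b) l1_sum" where
  "sgn_l1_sum p = p /\<^sub>R norm p"

definition uniformity_l1_sum :: "(('a, 'b) l1_sum \<times> ('a, 'b) l1_sum) filter" where
  "uniformity_l1_sum = (INF e\<in>{0<..}. principal {(p, q). dist p q < e})"

definition open_l1_sum :: "('a, 'b) l1_sum set \<Rightarrow> bool" where
  "open_l1_sum S \<longleftrightarrow> (\<forall>p\<in>S. \<forall>\<^sub>F (p', q) in uniformity. p' = p \<longrightarrow> q \<in> S)"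

instance
proof
  fix a :: real and p q :: "('a, 'b) l1_sum"
  show "norm (p + q) \<le> norm p + norm q"
    by transfer (auto simp: split_beta intro: order_trans[OF add_mono[OF norm_triangle_ineq norm_triangle_ineq]])
  show "norm (a *\<^sub>R p) = \<bar>a\<bar> * norm p"
    by transfer (auto simp: algebra_simps)
  show "norm p = 0 \<longleftrightarrow> p = 0"
    by transfer (auto simp: zero_prod_def add_nonneg_eq_0_iff)
qed (simp_all add: dist_l1_sum_def sgn_l1_sum_def uniformity_l1_sum_def open_l1_sum_def)

end

instance l1_sum :: (banach, banach) banach
proof
  fix P :: "nat \<Rightarrow> ('a, 'b) l1_sum"
  assume P: "Cauchy P"
  define X where "X n = fst (l1_pair (P n))" for n
  define Y where "Y n = snd (l1_pair (P n))" for n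
  have d: "dist (P m) q = dist (X m) (fst (l1_pair q)) + dist (Y m) (snd (l1_pair q))" for m q
    by (simp add: X_def Y_def dist_norm norm_l1_sum.rep_eq minus_l1_sum.rep_eq split_beta)
  have d': "dist (P m) (P n) = dist (X m) (X n) + dist (Y m) (Y n)" for m n
    by (simp add: d X_def Y_def)
  have "dist (X m) (X n) \<le> dist (P m) (P n)" "dist (Y m) (Y n) \<le> dist (P m) (P n)" for m n
    by (simp_all add: d')
  then have "Cauchy X" "Cauchy Y"
    using P unfolding Cauchy_def by (meson le_less_trans)+
  then obtain x y where "X \<longlonglongrightarrow> x" "Y \<longlonglongrightarrow> y"
    using Cauchy_convergent_iff convergent_def by metis
  then have "(\<lambda>n. dist (X n) x + dist (Y n) y) \<longlonglongrightarrow> 0"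
    by (auto intro!: tendsto_add_zero simp flip: tendsto_dist_iff)
  then have "P \<longlonglongrightarrow> L1_pair (x, y)"
    by (subst tendsto_dist_iff) (simp add: d L1_pair_inverse)
  then show "convergent P"
    by (rule convergentI)
qed

section \<open>The Banach--Mazur distance\<close>

text \<open>The values are in \<open>ennreal\<close>, so that the infimum over the empty set is \<open>\<infinity>\<close>: a finite bound on
  the distance entails that the two spaces are isomorphic.\<close>

definition banach_mazur_dist ::
    "'a::real_normed_vector itself \<Rightarrow> 'b::real_normed_vector itself \<Rightarrow> ennreal" where
  "banach_mazur_dist _ _ =
    (INF T \<in> {T :: 'a \<Rightarrow> 'b. bounded_linear T \<and> bij T \<and> bounded_linear (inv T)}.
      ennreal (onorm T * onorm (inv T)))"

end

theory Submission
  imports Defs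
begin

text \<open>Cut \<open>X\<close> into the cells \<open>exp (8 * k) \<le> norm x \<le> exp (8 * (k + 1))\<close>. Dilations
  \<open>x \<mapsto> exp (- 8 * a) * f (exp (8 * a) *\<^sub>R x)\<close> are isometries of the Lipschitz functions, so the
  pieces of \<open>f\<close> on two different cells can be compared, and rotated into each other by an angle that
  grows with \<open>ln (norm x)\<close> from \<open>0\<close> to a quarter turn across the cell. As the angle varies slowly,
  the rotation and its inverse have norm close to \<open>sqrt 2\<close>, hence at most \<open>2\<close>; its effect is to
  exchange the continuations of the two pieces. Doing this for suitable disjoint pairs of cells turns
  the single chain of cells, indexed by the integers, into two such chains, that is, \<open>f\<close> into a pair
  of Lipschitz functions. The isomorphism is weak-star continuous: each value of the image is a
  finite combination of values of \<open>f\<close>. Its preadjoint is the required isomorphism of free spaces.\<close>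

section \<open>Lipschitz bounds checked piecewise along segments\<close>

text \<open>On an interval covered by finitely many closed sets, a Lipschitz constant valid on each
  set is valid throughout. Cells accumulate at the origin, so segments through it are treated apart:
  there the norms of the endpoints add up to their distance, and \<open>zero\<close>
  suffices.\<close>

lemma lipschitz_on_UNIV_segmentwise:
  fixes F :: "'a::real_normed_vector \<Rightarrow> real"
  assumes C: "0 \<le> C"
    and closed: "\<And>k. k \<in> I \<Longrightarrow> closed (U k)"
    and lip: "\<And>k. k \<in> I \<Longrightarrow> C-lipschitz_on (U k) F"
    and fin: "\<And>x y. 0 \<notin> closed_segment x y \<Longrightarrow> \<exists>J\<subseteq>I. finite J \<and> closed_segment x y \<subseteq> (\<Union>k\<in>J. U k)"
    and zero: "\<And>x. \<bar>F x\<bar> \<le> C * norm x"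
  shows "C-lipschitz_on UNIV F"
proof (rule lipschitz_onI[OF _ C])
  fix x y :: 'a
  show "dist (F x) (F y) \<le> C * dist x y"
  proof (cases "0 \<in> closed_segment x y")
    case True
    then obtain u where u: "0 \<le> u" "u \<le> 1" "(1 - u) *\<^sub>R x + u *\<^sub>R y = 0"
      by (auto simp: in_segment)
    then have "x = u *\<^sub>R (x - y)" "y = (1 - u) *\<^sub>R (y - x)"
      by (simp_all add: algebra_simps)
    then have "norm x = u * dist x y" "norm y = (1 - u) * dist x y"
      using u(1,2) by (metis abs_of_nonneg dist_commute dist_norm norm_scaleR diff_ge_0_iff_ge)+
    then have "norm x + norm y = dist x y"
      by (simp add: left_diff_distrib)
    then have "C * dist x y = C * norm x + C * norm y"
      by (metis distrib_left)
    then show ?thesis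
      using zero[of x] zero[of y] by (simp add: dist_real_def)
  next
    case False
    then obtain J where J: "J \<subseteq> I" "finite J" "closed_segment x y \<subseteq> (\<Union>k\<in>J. U k)"
      using fin[OF False] by metis
    define p where "p t = x + t *\<^sub>R (y - x)" for t
    have p: "p ` {0..1} = closed_segment x y"
      unfolding closed_segment_image_interval p_def
      by (intro image_cong) (simp_all add: algebra_simps)
    have cont: "continuous_on A p" for A
      unfolding p_def by (intro continuous_intros)
    have "(C * dist x y)-lipschitz_on {0..1} (\<lambda>t. F (p t))"
    proof (rule lipschitz_on_closed_Union[OF _ _ J(2)])
      fix k assume k: "k \<in> J"
      show "closed (p -` U k)"
        using closed k J(1) cont[of UNIV] by (intro closed_vimage) auto
      show "(C * dist x y)-lipschitz_on (p -` U k) (\<lambda>t. F (p t))"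
      proof (rule lipschitz_onI)
        fix s t assume "s \<in> p -` U k" "t \<in> p -` U k"
        then have "dist (F (p s)) (F (p t)) \<le> C * dist (p s) (p t)"
          using lip[of k] k J(1) by (intro lipschitz_onD) auto
        also have "dist (p s) (p t) = dist x y * dist s t"
        proof -
          have "p s - p t = (s - t) *\<^sub>R (y - x)"
            by (simp add: p_def algebra_simps)
          then show ?thesis
            by (simp add: dist_norm norm_minus_commute)
        qed
        finally show "dist (F (p s)) (F (p t)) \<le> C * dist x y * dist s t"
          by (simp add: mult.assoc)
      qed (simp add: C)
    next
      show "{0..1} \<subseteq> (\<Union>k\<in>J. p -` U k)"
        using J(3) unfolding p[symmetric] by blast
    qed (simp add: C)
    then have "dist (F (p 0)) (F (p 1)) \<le> C * dist x y * dist 0 (1::real)"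
      by (rule lipschitz_onD) auto
    then show ?thesis
      by (simp add: p_def)
  qed
qed

section \<open>Gluing a sequence of Lipschitz functions along spheres\<close>

text \<open>The factor \<open>8\<close> makes the weights below so slowly varying in \<open>norm x\<close> that they cost little
  in Lipschitz norm: \<open>3/2 + 1/2\<close> instead of \<open>3/2\<close>, where \<open>3/2\<close> bounds \<open>\<bar>cos\<bar> + \<bar>sin\<bar>\<close>. At the origin,
  \<open>phase 0 = 0\<close> is a junk value; all functions involved vanish there.\<close>

definition phase :: "'a::real_normed_vector \<Rightarrow> real" where
  "phase x = ln (norm x) / 8"

abbreviation cell :: "'a::real_normed_vector \<Rightarrow> int" where
  "cell x \<equiv> \<lfloor>phase x\<rfloor>"

definition blend :: "real \<Rightarrow> real \<Rightarrow> real \<Rightarrow> real" where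
  "blend u a b = cos (pi / 2 * u) * a + sin (pi / 2 * u) * b"

lemma blend_0 [simp]: "blend 0 a b = a" and blend_1 [simp]: "blend 1 a b = b"
  by (simp_all add: blend_def)

lemma abs_blend_le:
  assumes "\<bar>a\<bar> \<le> C" "\<bar>b\<bar> \<le> C"
  shows "\<bar>blend u a b\<bar> \<le> 3 / 2 * C"
proof -
  define c s where "c = \<bar>cos (pi / 2 * u)\<bar>" and "s = \<bar>sin (pi / 2 * u)\<bar>"
  \<comment> \<open>Adding the square of \<open>c - s\<close> cancels the mixed term and leaves
    twice \<open>cos^2 + sin^2\<close>.\<close>
  have "(c + s)\<^sup>2 \<le> (c + s)\<^sup>2 + (c - s)\<^sup>2"
    by simp
  also have "\<dots> = 2"
    using sin_cos_squared_add[of "pi / 2 * u"]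
    by (simp add: c_def s_def power2_sum power2_diff)
  also have "\<dots> \<le> (3 / 2)\<^sup>2"
    by (simp add: power2_eq_square)
  finally have cs: "c + s \<le> 3 / 2"
    by (rule power2_le_imp_le) simp
  have "\<bar>blend u a b\<bar> \<le> c * \<bar>a\<bar> + s * \<bar>b\<bar>"
    unfolding blend_def c_def s_def by (metis abs_mult abs_triangle_ineq)
  also have "\<dots> \<le> c * C + s * C"
    using assms by (intro add_mono mult_left_mono) (auto simp: c_def s_def)
  also have "\<dots> = (c + s) * C"
    by (simp add: distrib_right)
  also have "\<dots> \<le> 3 / 2 * C"
    using cs assms(1) by (intro mult_right_mono) auto
  finally show ?thesis .
qed

text \<open>This is \<open>ln t \<le> t - 1\<close> at \<open>t = norm x / norm y\<close>. The
  factor \<open>norm y\<close> matches the linear growth of Lipschitz functions vanishing at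
  0.\<close>

lemma abs_phase_diff_le:
  assumes "y \<noteq> 0" "norm y \<le> norm x"
  shows "\<bar>phase x - phase y\<bar> * norm y \<le> norm (x - y) / 8"
proof -
  have pos: "0 < norm y" "0 < norm x"
    using assms by (auto intro: less_le_trans)
  have "ln (norm x / norm y) \<le> norm x / norm y - 1"
    using pos by (intro ln_le_minus_one) simp
  then have "ln (norm x) - ln (norm y) \<le> (norm x - norm y) / norm y"
    using pos by (simp add: ln_div diff_divide_distrib)
  then have "(ln (norm x) - ln (norm y)) * norm y \<le> norm x - norm y"
    using pos by (simp add: pos_le_divide_eq)
  moreover have "ln (norm y) \<le> ln (norm x)"
    using pos assms by simp
  moreover have "norm x - norm y \<le> norm (x - y)"
    by (rule norm_triangle_ineq2)
  ultimately show ?thesis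
    by (simp add: phase_def abs_if diff_divide_distrib[symmetric])
qed

lemma abs_cos_diff_le: "\<bar>cos a - cos b\<bar> \<le> \<bar>a - b\<bar>" for a b :: real
proof -
  have "\<bar>cos a - cos b\<bar> = 2 * \<bar>sin ((a + b) / 2)\<bar> * \<bar>sin ((b - a) / 2)\<bar>"
    by (simp add: cos_diff_cos abs_mult)
  also have "\<dots> \<le> 2 * 1 * \<bar>(b - a) / 2\<bar>"
    by (intro mult_mono abs_sin_x_le_abs_x) auto
  finally show ?thesis by simp
qed

lemma abs_sin_diff_le: "\<bar>sin a - sin b\<bar> \<le> \<bar>a - b\<bar>" for a b :: real
  using abs_cos_diff_le[of "a - pi / 2" "b - pi / 2"] by (simp add: cos_diff)

lemma abs_blend_diff_le: "\<bar>blend u a b - blend v a b\<bar> \<le> 2 * \<bar>u - v\<bar> * (\<bar>a\<bar> + \<bar>b\<bar>)"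
proof -
  have d: "\<bar>pi / 2 * u - pi / 2 * v\<bar> \<le> 2 * \<bar>u - v\<bar>"
  proof -
    have "\<bar>pi / 2 * u - pi / 2 * v\<bar> = pi / 2 * \<bar>u - v\<bar>"
      unfolding right_diff_distrib[symmetric] abs_mult by simp
    also have "\<dots> \<le> 2 * \<bar>u - v\<bar>"
      using pi_less_4 by (intro mult_right_mono) auto
    finally show ?thesis .
  qed
  have "\<bar>blend u a b - blend v a b\<bar>
      \<le> \<bar>cos (pi / 2 * u) - cos (pi / 2 * v)\<bar> * \<bar>a\<bar> + \<bar>sin (pi / 2 * u) - sin (pi / 2 * v)\<bar> * \<bar>b\<bar>"
    unfolding blend_def abs_mult[symmetric] by (rule order_trans[OF _ abs_triangle_ineq]) (simp add: algebra_simps)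
  also have "\<dots> \<le> (2 * \<bar>u - v\<bar>) * \<bar>a\<bar> + (2 * \<bar>u - v\<bar>) * \<bar>b\<bar>"
    using d by (intro add_mono mult_right_mono order_trans[OF abs_cos_diff_le] order_trans[OF abs_sin_diff_le]) auto
  finally show ?thesis
    by (simp add: distrib_left)
qed

text \<open>A product rule: changing the values at a fixed angle costs \<open>3 / 2 * C\<close>,
  changing the angle at fixed values costs \<open>4 * C / 8\<close>. The values are fixed at the
  point of smaller norm, as \<open>abs_phase_diff_le\<close> demands.\<close>

lemma blend_phase_lipschitz:
  assumes f: "norm f \<le> C" and g: "norm g \<le> C" and "x \<noteq> 0" "y \<noteq> 0"
  shows "\<bar>blend (phase x - k) (lip0_apply f x) (lip0_apply g x)
          - blend (phase y - k) (lip0_apply f y) (lip0_apply g y)\<bar> \<le> 2 * C * dist x y"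
    (is "\<bar>?F x - ?F y\<bar> \<le> _")
proof -
  have *: "\<bar>?F x - ?F y\<bar> \<le> 2 * C * dist x y" if "y \<noteq> 0" "norm y \<le> norm x" for x y
  proof -
    have C: "0 \<le> C"
      using f norm_ge_zero order_trans by blast
    have diff: "\<bar>lip0_apply h x - lip0_apply h y\<bar> \<le> C * dist x y" if "norm h \<le> C" for h
      using lip0_norm_bound[of h x y] mult_right_mono[OF that, of "dist x y"]
      by (simp add: norm_lip0_def)
    have bound: "\<bar>lip0_apply h y\<bar> \<le> C * norm y" if "norm h \<le> C" for h
      using lip0_apply_bound[of h y] mult_right_mono[OF that, of "norm y"] by simp
    have "\<bar>?F x - ?F y\<bar>
        \<le> \<bar>blend (phase x - k) (lip0_apply f x - lip0_apply f y) (lip0_apply g x - lip0_apply g y)\<bar>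
          + \<bar>blend (phase x - k) (lip0_apply f y) (lip0_apply g y)
            - blend (phase y - k) (lip0_apply f y) (lip0_apply g y)\<bar>"
      by (rule order_trans[OF _ abs_triangle_ineq]) (simp add: blend_def algebra_simps)
    also have "\<dots> \<le> 3 / 2 * (C * dist x y) + 2 * \<bar>phase x - phase y\<bar> * (C * norm y + C * norm y)"
      by (intro add_mono abs_blend_le order_trans[OF abs_blend_diff_le] mult_mono diff bound f g) auto
    also have "\<dots> = 3 / 2 * (C * dist x y) + 4 * C * (\<bar>phase x - phase y\<bar> * norm y)"
      by simp
    also have "\<dots> \<le> 3 / 2 * (C * dist x y) + 4 * C * (norm (x - y) / 8)"
      using C abs_phase_diff_le[OF that] by (intro add_left_mono mult_left_mono) auto
    finally show ?thesis
      by (simp add: dist_norm)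
  qed
  show ?thesis
    using *[of y x] *[of x y] assms(3,4)
    by (cases "norm y \<le> norm x") (auto simp: dist_commute abs_minus_commute)
qed

text \<open>\<open>A k\<close> lives around the sphere of radius \<open>exp (8 * k)\<close>; on a cell \<open>k\<close> with \<open>\<not> P k\<close> there is no
  rotation, and the value is only sensible if \<open>A k = A (k + 1)\<close>.\<close>

definition glue_fun :: "(int \<Rightarrow> bool) \<Rightarrow> (int \<Rightarrow> 'a::real_normed_vector lip0) \<Rightarrow> 'a \<Rightarrow> real" where
  "glue_fun P A x = (if P (cell x)
    then blend (frac (phase x)) (lip0_apply (A (cell x)) x) (lip0_apply (A (cell x + 1)) x)
    else lip0_apply (A (cell x)) x)"

text \<open>Where \<open>phase x = k + 1\<close> the floor already jumps to \<open>k + 1\<close>,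
  but the formula for \<open>k\<close> still gives \<open>A (k + 1)\<close>: the rotation is
  complete there, or \<open>comp\<close> applies. Hence the formula holds up to the boundary, which
  makes closed pieces possible.\<close>

lemma glue_fun_closed_cell:
  assumes comp: "\<And>k. P k \<or> A k = A (k + 1)" and x: "of_int k \<le> phase x" "phase x \<le> of_int k + 1"
  shows "glue_fun P A x = (if P k
    then blend (phase x - of_int k) (lip0_apply (A k) x) (lip0_apply (A (k + 1)) x)
    else lip0_apply (A k) x)"
proof (cases "phase x = of_int k + 1")
  case True
  then have "cell x = k + 1" "frac (phase x) = 0"
    by (auto simp: frac_def)
  with True comp[of k] show ?thesis
    by (auto simp: glue_fun_def)
next
  case False
  then have "cell x = k"
    using x by (intro floor_unique) auto
  then show ?thesis
    by (simp add: glue_fun_def frac_def)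
qed

lemma glue_fun_lipschitz:
  fixes A :: "int \<Rightarrow> 'a::real_normed_vector lip0"
  assumes bd: "\<And>k. norm (A k) \<le> C" and comp: "\<And>k. P k \<or> A k = A (k + 1)"
  shows "(2 * C)-lipschitz_on UNIV (glue_fun P A)"
proof (rule lipschitz_on_UNIV_segmentwise)
  have C: "0 \<le> C"
    using bd norm_ge_zero order_trans by blast
  then show "0 \<le> 2 * C"
    by simp
  define U where "U k = {x :: 'a. exp (8 * of_int k) \<le> norm x \<and> norm x \<le> exp (8 * (of_int k + 1))}" for k :: int
  have U: "x \<noteq> 0" "of_int k \<le> phase x" "phase x \<le> of_int k + 1" if "x \<in> U k" for x k
  proof -
    have "exp (8 * of_int k) \<le> norm x"
      using that by (simp add: U_def)
    then have pos: "0 < norm x"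
      by (rule less_le_trans[OF exp_gt_zero])
    then show "x \<noteq> 0"
      by auto
    have "norm x = exp (8 * phase x)"
      using pos by (simp add: phase_def)
    then show "of_int k \<le> phase x" "phase x \<le> of_int k + 1"
      using that by (simp_all add: U_def)
  qed
  have U_cell: "x \<in> U (cell x)" if "x \<noteq> 0" for x :: 'a
  proof -
    have "norm x = exp (8 * phase x)"
      using that by (simp add: phase_def)
    moreover have "of_int (cell x) \<le> phase x" "phase x \<le> of_int (cell x) + 1"
      by linarith+
    ultimately show ?thesis
      unfolding U_def by simp linarith
  qed
  show "closed (U k)" for k
    unfolding U_def by (intro closed_Collect_conj closed_Collect_le continuous_intros)
  show "(2 * C)-lipschitz_on (U k) (glue_fun P A)" for k
  proof (rule lipschitz_onI)
    fix x y assume xy: "x \<in> U k" "y \<in> U k"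
    have "\<bar>lip0_apply (A k) x - lip0_apply (A k) y\<bar> \<le> C * dist x y"
      using lip0_norm_bound[of "A k" x y] mult_right_mono[OF bd[of k], of "dist x y"]
      by (simp add: norm_lip0_def)
    also have "\<dots> \<le> 2 * C * dist x y"
      using C by (intro mult_right_mono) auto
    finally show "dist (glue_fun P A x) (glue_fun P A y) \<le> 2 * C * dist x y"
      using blend_phase_lipschitz[OF bd[of k] bd[of "k + 1"] U(1)[OF xy(1)] U(1)[OF xy(2)], of "of_int k"]
      by (simp add: glue_fun_closed_cell[of P A, OF comp U(2,3)[OF xy(1)]]
          glue_fun_closed_cell[of P A, OF comp U(2,3)[OF xy(2)]] dist_real_def)
  qed (simp add: C)
  show "\<exists>J\<subseteq>UNIV. finite J \<and> closed_segment x y \<subseteq> (\<Union>k\<in>J. U k)"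
    if "0 \<notin> closed_segment x y" for x y
  proof -
    \<comment> \<open>By compactness \<open>phase\<close> is bounded on the segment, so finitely
      many cells cover it.\<close>
    have "continuous_on (closed_segment x y) (\<lambda>z. phase z :: real)"
      unfolding phase_def using that by (intro continuous_intros) auto
    then have "compact (phase ` closed_segment x y)"
      by (intro compact_continuous_image compact_segment)
    then have "\<exists>b. \<forall>z\<in>closed_segment x y. \<bar>phase z\<bar> \<le> b"
      by (auto dest!: compact_imp_bounded simp: bounded_iff)
    then obtain b where b: "\<And>z. z \<in> closed_segment x y \<Longrightarrow> \<bar>phase z\<bar> \<le> b"
      by blast
    have "z \<in> (\<Union>k\<in>{\<lfloor>-b\<rfloor>..\<lfloor>b\<rfloor>}. U k)" if "z \<in> closed_segment x y" for z
      using b[OF that] U_cell[of z] that \<open>0 \<notin> closed_segment x y\<close>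
      by (intro UN_I[of "cell z"]) (auto intro!: floor_mono)
    then show ?thesis
      by (intro exI[of _ "{\<lfloor>-b\<rfloor>..\<lfloor>b\<rfloor>}"]) auto
  qed
  show "\<bar>glue_fun P A x\<bar> \<le> 2 * C * norm x" for x
  proof -
    have bound: "\<bar>lip0_apply (A k) x\<bar> \<le> C * norm x" for k
      using lip0_apply_bound[of "A k" x] mult_right_mono[OF bd[of k], of "norm x"] by simp
    have "\<bar>glue_fun P A x\<bar> \<le> 3 / 2 * (C * norm x)"
      using abs_blend_le[OF bound bound, of "frac (phase x)"] bound[of "cell x"]
      by (auto simp: glue_fun_def)
    also have "\<dots> \<le> 2 * C * norm x"
      using mult_nonneg_nonneg[OF C norm_ge_zero[of x]] by simp
    finally show ?thesis .
  qed
qed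

text \<open>\<open>Lip0\<close> has a known value only on Lipschitz functions vanishing at 0;
  \<open>glueable P A C\<close>, for any \<open>C\<close>, ensures this.\<close>

definition glue :: "(int \<Rightarrow> bool) \<Rightarrow> (int \<Rightarrow> 'a::real_normed_vector lip0) \<Rightarrow> 'a lip0" where
  "glue P A = Lip0 (glue_fun P A)"

definition glueable :: "(int \<Rightarrow> bool) \<Rightarrow> (int \<Rightarrow> 'a::real_normed_vector lip0) \<Rightarrow> real \<Rightarrow> bool" where
  "glueable P A C \<longleftrightarrow> (\<forall>k. norm (A k) \<le> C) \<and> (\<forall>k. P k \<or> A k = A (k + 1))"

lemma glueable_lipschitz: "glueable P A C \<Longrightarrow> (2 * C)-lipschitz_on UNIV (glue_fun P A)"
  by (rule glue_fun_lipschitz) (auto simp: glueable_def)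

lemma lip0_apply_glue: "glueable P A C \<Longrightarrow> lip0_apply (glue P A) = glue_fun P A"
  unfolding glue_def using glueable_lipschitz[of P A C]
  by (intro Lip0_inverse) (auto simp: glue_fun_def blend_def)

lemma norm_glue_le:
  assumes "glueable P A C"
  shows "norm (glue P A) \<le> 2 * C"
  unfolding norm_lip0_def using glueable_lipschitz[OF assms]
  by (intro lip0_norm_leI)
    (auto simp: lip0_apply_glue[OF assms] lipschitz_on_def dist_real_def)

section \<open>Dilations and rotations\<close>

lemma dist_scaleR_exp: "dist (exp r *\<^sub>R x) (exp r *\<^sub>R y) = exp r * dist x y"
  for x y :: "'a::real_normed_vector"
  by (simp add: dist_norm flip: scaleR_diff_right)

text \<open>The exponent 8 is the logarithmic width of a cell: on cell \<open>k\<close>,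
  \<open>dil a f\<close> reads \<open>f\<close> on cell \<open>k + a\<close>, at the same relative
  position.\<close>

lift_definition dil :: "int \<Rightarrow> 'a::real_normed_vector lip0 \<Rightarrow> 'a lip0"
  is "\<lambda>a f x. exp (- 8 * of_int a) * f (exp (8 * of_int a) *\<^sub>R x)"
proof -
  fix a :: int and f :: "'a \<Rightarrow> real"
  assume "(\<exists>C. C-lipschitz_on UNIV f) \<and> f 0 = 0"
  then obtain C where C: "C-lipschitz_on UNIV f" and f0: "f 0 = 0" by blast
  have "C-lipschitz_on UNIV (\<lambda>x. exp (- 8 * of_int a) * f (exp (8 * of_int a) *\<^sub>R x))"
  proof (rule lipschitz_onI)
    fix x y
    have "dist (f (exp (8 * of_int a) *\<^sub>R x)) (f (exp (8 * of_int a) *\<^sub>R y)) \<le> C * (exp (8 * of_int a) * dist x y)"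
      using lipschitz_onD[OF C, of "exp (8 * of_int a) *\<^sub>R x" "exp (8 * of_int a) *\<^sub>R y"]
      by (simp add: dist_scaleR_exp)
    then show "dist (exp (- 8 * of_int a) * f (exp (8 * of_int a) *\<^sub>R x))
        (exp (- 8 * of_int a) * f (exp (8 * of_int a) *\<^sub>R y)) \<le> C * dist x y"
      by (simp add: dist_real_def exp_minus field_simps flip: right_diff_distrib)
  qed (rule lipschitz_on_nonneg[OF C])
  with f0 show "(\<exists>C. C-lipschitz_on UNIV (\<lambda>x. exp (- 8 * of_int a) * f (exp (8 * of_int a) *\<^sub>R x)))
      \<and> exp (- 8 * of_int a) * f (exp (8 * of_int a) *\<^sub>R 0) = 0"
    by auto
qed

lemma lip0_apply_dil:
  "lip0_apply (dil a f) x = exp (- 8 * of_int a) * lip0_apply f (exp (8 * of_int a) *\<^sub>R x)"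
  by transfer simp

lemma dil_0 [simp]: "dil 0 f = f"
  by (rule lip0_eqI) (simp add: lip0_apply_dil)

lemma dil_dil [simp]: "dil a (dil b f) = dil (a + b) f"
  by (rule lip0_eqI) (simp add: lip0_apply_dil exp_add[symmetric] algebra_simps flip: mult.assoc)

lemma dil_add: "dil a (f + g) = dil a f + dil a g"
  and dil_scaleR: "dil a (r *\<^sub>R f) = r *\<^sub>R dil a f"
  and dil_minus: "dil a (- f) = - dil a f"
  by (rule lip0_eqI, simp add: lip0_apply_dil algebra_simps)+

lemma norm_dil_le: "norm (dil a f) \<le> norm f"
  unfolding norm_lip0_def
proof (rule lip0_norm_leI)
  fix x y
  show "\<bar>lip0_apply (dil a f) x - lip0_apply (dil a f) y\<bar> \<le> lip0_norm f * dist x y"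
    using lip0_norm_bound[of f "exp (8 * of_int a) *\<^sub>R x" "exp (8 * of_int a) *\<^sub>R y"]
    by (simp add: lip0_apply_dil exp_minus dist_scaleR_exp abs_mult field_simps flip: right_diff_distrib)
qed (rule lip0_norm_nonneg)

lemma phase_dilation: "x \<noteq> 0 \<Longrightarrow> phase (exp (8 * of_int a) *\<^sub>R x) = phase x + of_int a"
  by (simp add: phase_def ln_mult field_simps)

lemma glueable_dil:
  assumes "glueable P A C"
  shows "glueable (\<lambda>k. P (k + a)) (\<lambda>k. dil a (A (k + a))) C"
  unfolding glueable_def
proof (intro conjI allI)
  fix k
  show "norm (dil a (A (k + a))) \<le> C"
    using assms norm_dil_le order_trans unfolding glueable_def by blast
  have "P (k + a) \<or> A (k + a) = A (k + a + 1)"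
    using assms unfolding glueable_def by blast
  then show "P (k + a) \<or> dil a (A (k + a)) = dil a (A (k + 1 + a))"
    by (auto simp: ac_simps)
qed

text \<open>A dilation adds the integer \<open>a\<close> to the phase, so it shifts cells and leaves
  the rotation angle unchanged.\<close>

lemma dil_glue:
  assumes "glueable P A C"
  shows "dil a (glue P A) = glue (\<lambda>k. P (k + a)) (\<lambda>k. dil a (A (k + a)))"
proof (rule lip0_eqI)
  fix x
  note glue = lip0_apply_glue[OF assms] lip0_apply_glue[OF glueable_dil[OF assms]]
  show "lip0_apply (dil a (glue P A)) x = lip0_apply (glue (\<lambda>k. P (k + a)) (\<lambda>k. dil a (A (k + a)))) x"
  proof (cases "x = 0")
    case False
    then have "phase (exp (8 * of_int a) *\<^sub>R x) = phase x + of_int a"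
      by (rule phase_dilation)
    moreover from this have "cell (exp (8 * of_int a) *\<^sub>R x) = cell x + a"
      by simp
    ultimately show ?thesis
      by (simp add: lip0_apply_dil glue glue_fun_def blend_def frac_def algebra_simps)
  qed simp
qed

lemma lip0_apply_dil_glue:
  assumes "glueable P A C"
  shows "lip0_apply (dil a (glue P A)) x = (if P (cell x + a)
    then blend (frac (phase x)) (lip0_apply (dil a (A (cell x + a))) x) (lip0_apply (dil a (A (cell x + a + 1))) x)
    else lip0_apply (dil a (A (cell x + a))) x)"
  unfolding dil_glue[OF assms] lip0_apply_glue[OF glueable_dil[OF assms]] glue_fun_def
  by (simp add: ac_simps)

text \<open>The pair \<open>(blend u a (- b), blend u b a)\<close> is \<open>(a, b)\<close> rotated,
  and the outer \<open>blend\<close> is the first coordinate after rotating back. The other form has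
  the sign of \<open>b\<close> reversed.\<close>

lemma blend_inverse: "blend u (blend u a b) (blend u (- b) a) = a"
  and blend_inverse': "blend u (blend u a (- b)) (blend u b a) = a"
proof -
  show *: "blend u (blend u a b) (blend u (- b) a) = a" for b
    using sin_cos_squared_add[of "pi / 2 * u"]
    by (simp add: blend_def power2_eq_square algebra_simps flip: distrib_left)
  show "blend u (blend u a (- b)) (blend u b a) = a"
    using *[of "- b"] by simp
qed

lemma blend_uminus: "- blend u a b = blend u (- a) (- b)"
  by (simp add: blend_def)

lemmas blend_inverses = blend_inverse blend_inverse' blend_uminus

section \<open>Splitting one strand into two\<close>

text \<open>Cells are paired by the involution \<open>0 \<leftrightarrow> 3\<close>, \<open>2 \<leftrightarrow> 5\<close>, \<open>4 \<leftrightarrow> 7\<close>, \<open>6 \<leftrightarrow> 9\<close>, \<open>\<dots>\<close>, fixing \<open>1\<close> and the negative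
  cells. Across a pair the two pieces of a function are rotated by a quarter turn, so that a cell is
  now followed by the successor of its partner. The new order consists of the two chains
  \<open>\<dots>, -2, -1, 0, 4, 8, \<dots>\<close> and \<open>\<dots>, 7, 5, 3, 1, 2, 6, 10, \<dots>\<close>, which are renumbered by the integers,
  the cells \<open>0\<close> and \<open>1\<close> getting the number \<open>0\<close>. The signs come from the quarter turns.\<close>

definition strand1 :: "'a::real_normed_vector lip0 \<Rightarrow> int \<Rightarrow> 'a lip0" where
  "strand1 f n = dil (3 * max n 0) f"

text \<open>The exponent is old cell minus new number: number \<open>n \<ge> 1\<close> is cell
  \<open>4 * n - 2\<close>, and number \<open>n \<le> 0\<close> is cell
  \<open>1 - 2 * n\<close>.\<close>

definition strand2 :: "'a::real_normed_vector lip0 \<Rightarrow> int \<Rightarrow> 'a lip0" where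
  "strand2 f n = (if 1 \<le> n then dil (3 * n - 2) f
    else if even n then dil (1 - 3 * n) f else - dil (1 - 3 * n) f)"

text \<open>The exponent is strand number minus cell: cell \<open>4 * j\<close> is number
  \<open>j\<close> of the first strand, while \<open>4 * j + 1\<close>, \<open>4 * j + 2\<close>,
  \<open>4 * j + 3\<close> are numbers \<open>- 2 * j\<close>, \<open>j + 1\<close>,
  \<open>- 2 * j - 1\<close> of the second.\<close>

definition braid :: "'a::real_normed_vector lip0 \<Rightarrow> 'a lip0 \<Rightarrow> int \<Rightarrow> 'a lip0" where
  "braid g h m = (if m \<le> 0 then g
    else if m mod 4 = 0 then dil (- 3 * (m div 4)) g
    else if m mod 4 = 1 then dil (- 6 * (m div 4) - 1) h
    else if m mod 4 = 2 then dil (- 3 * (m div 4) - 1) h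
    else - dil (- 6 * (m div 4) - 4) h)"

definition split1 :: "'a::real_normed_vector lip0 \<Rightarrow> 'a lip0" where
  "split1 f = glue (\<lambda>n. 0 \<le> n) (strand1 f)"

definition split2 :: "'a::real_normed_vector lip0 \<Rightarrow> 'a lip0" where
  "split2 f = glue (\<lambda>n. n \<noteq> 0) (strand2 f)"

definition unsplit :: "'a::real_normed_vector lip0 \<Rightarrow> 'a lip0 \<Rightarrow> 'a lip0" where
  "unsplit g h = glue (\<lambda>m. 0 \<le> m \<and> m \<noteq> 1) (braid g h)"

text \<open>On unrotated cells adjacent pieces coincide: \<open>f\<close> up to number 0 of the
  first strand, \<open>dil 1 f\<close> at numbers 0 and 1 of the second, and in \<open>braid\<close>
  the piece \<open>g\<close> up to 0 and \<open>dil (- 1) h\<close> at 1 and 2.\<close>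

lemma glueable_strand1: "glueable (\<lambda>n. 0 \<le> n) (strand1 f) (norm f)"
  by (auto simp: glueable_def strand1_def norm_dil_le max_def)

lemma glueable_strand2: "glueable (\<lambda>n. n \<noteq> 0) (strand2 f) (norm f)"
  by (auto simp: glueable_def strand2_def norm_dil_le)

lemma glueable_braid: "glueable (\<lambda>m. 0 \<le> m \<and> m \<noteq> 1) (braid g h) (max (norm g) (norm h))"
  by (auto simp: glueable_def braid_def
      intro: order_trans[OF norm_dil_le max.cobounded1] order_trans[OF norm_dil_le max.cobounded2])

lemma norm_split1_le: "norm (split1 f) \<le> 2 * norm f"
  unfolding split1_def by (rule norm_glue_le[OF glueable_strand1])

lemma norm_split2_le: "norm (split2 f) \<le> 2 * norm f"
  unfolding split2_def by (rule norm_glue_le[OF glueable_strand2])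

lemma norm_unsplit_le: "norm (unsplit g h) \<le> 2 * max (norm g) (norm h)"
  unfolding unsplit_def by (rule norm_glue_le[OF glueable_braid])

lemma lip0_apply_split1: "lip0_apply (split1 f) = glue_fun (\<lambda>n. 0 \<le> n) (strand1 f)"
  unfolding split1_def by (rule lip0_apply_glue[OF glueable_strand1])

lemma lip0_apply_split2: "lip0_apply (split2 f) = glue_fun (\<lambda>n. n \<noteq> 0) (strand2 f)"
  unfolding split2_def by (rule lip0_apply_glue[OF glueable_strand2])

lemma lip0_apply_unsplit: "lip0_apply (unsplit g h) = glue_fun (\<lambda>m. 0 \<le> m \<and> m \<noteq> 1) (braid g h)"
  unfolding unsplit_def by (rule lip0_apply_glue[OF glueable_braid])

text \<open>For \<open>0 \<le> n\<close> the two dilations read \<open>f\<close> on the partners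
  \<open>4 * n\<close> and \<open>4 * n + 3\<close>. The shift \<open>a\<close> stays free because
  \<open>unsplit\<close> evaluates its arguments after dilations.\<close>

lemma dil_split1_at:
  fixes x :: "'a::real_normed_vector"
  shows "cell x + a \<le> -1 \<Longrightarrow> lip0_apply (dil a (split1 f)) x = lip0_apply (dil a f) x"
    and "cell x + a = n \<Longrightarrow> 0 \<le> n \<Longrightarrow> lip0_apply (dil a (split1 f)) x
      = blend (frac (phase x)) (lip0_apply (dil (a + 3 * n) f) x) (lip0_apply (dil (a + 3 * n + 3) f) x)"
  by (simp_all only: split1_def lip0_apply_dil_glue[OF glueable_strand1])
    (simp_all add: strand1_def algebra_simps)

lemma dil_split2_at:
  fixes x :: "'a::real_normed_vector"
  shows "cell x + a = 0 \<Longrightarrow> lip0_apply (dil a (split2 f)) x = lip0_apply (dil (a + 1) f) x"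
    and "cell x + a = n \<Longrightarrow> 1 \<le> n \<Longrightarrow> lip0_apply (dil a (split2 f)) x
      = blend (frac (phase x)) (lip0_apply (dil (a + 3 * n - 2) f) x) (lip0_apply (dil (a + 3 * n + 1) f) x)"
    and "cell x + a = - 2 * j \<Longrightarrow> 1 \<le> j \<Longrightarrow> lip0_apply (dil a (split2 f)) x
      = blend (frac (phase x)) (lip0_apply (dil (a + 6 * j + 1) f) x) (- lip0_apply (dil (a + 6 * j - 2) f) x)"
    and "cell x + a = - 2 * j - 1 \<Longrightarrow> 0 \<le> j \<Longrightarrow> lip0_apply (dil a (split2 f)) x
      = blend (frac (phase x)) (- lip0_apply (dil (a + 6 * j + 4) f) x) (lip0_apply (dil (a + 6 * j + 1) f) x)"
  by (simp_all only: split2_def lip0_apply_dil_glue[OF glueable_strand2])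
    (simp_all add: strand2_def dil_minus algebra_simps)

lemma braid_at:
  "m \<le> 0 \<Longrightarrow> braid g h m = g"
  "0 \<le> j \<Longrightarrow> braid g h (4 * j) = dil (- 3 * j) g"
  "0 \<le> j \<Longrightarrow> braid g h (4 * j + 1) = dil (- 6 * j - 1) h"
  "0 \<le> j \<Longrightarrow> braid g h (4 * j + 2) = dil (- 3 * j - 1) h"
  "0 \<le> j \<Longrightarrow> braid g h (4 * j + 3) = - dil (- 6 * j - 4) h"
  by (auto simp: braid_def)

lemma four_mult_neq_one: "4 * j \<noteq> 1" for j :: int
  by presburger

lemma dil_unsplit_at:
  fixes x :: "'a::real_normed_vector"
  shows "cell x + a \<le> -1 \<Longrightarrow> lip0_apply (dil a (unsplit g h)) x = lip0_apply (dil a g) x"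
    and "cell x + a = 1 \<Longrightarrow> lip0_apply (dil a (unsplit g h)) x = lip0_apply (dil (a - 1) h) x"
    and "cell x + a = 4 * j \<Longrightarrow> 0 \<le> j \<Longrightarrow> lip0_apply (dil a (unsplit g h)) x
      = blend (frac (phase x)) (lip0_apply (dil (a - 3 * j) g) x) (lip0_apply (dil (a - 6 * j - 1) h) x)"
    and "cell x + a = 4 * j + 1 \<Longrightarrow> 1 \<le> j \<Longrightarrow> lip0_apply (dil a (unsplit g h)) x
      = blend (frac (phase x)) (lip0_apply (dil (a - 6 * j - 1) h) x) (lip0_apply (dil (a - 3 * j - 1) h) x)"
    and "cell x + a = 4 * j + 2 \<Longrightarrow> 0 \<le> j \<Longrightarrow> lip0_apply (dil a (unsplit g h)) x
      = blend (frac (phase x)) (lip0_apply (dil (a - 3 * j - 1) h) x) (- lip0_apply (dil (a - 6 * j - 4) h) x)"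
    and "cell x + a = 4 * j + 3 \<Longrightarrow> 0 \<le> j \<Longrightarrow> lip0_apply (dil a (unsplit g h)) x
      = blend (frac (phase x)) (- lip0_apply (dil (a - 6 * j - 4) h) x) (lip0_apply (dil (a - 3 * j - 3) g) x)"
  \<comment> \<open>The second argument of each \<open>blend\<close> is \<open>braid\<close> at the
    next index; after \<open>4 * j + 3\<close> that is \<open>4 * (j + 1)\<close>.\<close>
  using four_mult_neq_one braid_at(2-5)[of j g h] braid_at(3)[of 0 g h] braid_at(2)[of "j + 1" g h]
  by (simp_all only: unsplit_def lip0_apply_dil_glue[OF glueable_braid])
    (simp_all add: braid_at(1) dil_minus algebra_simps)

section \<open>Splitting and unsplitting are mutually inverse\<close>

text \<open>Number \<open>n \<ge> 0\<close> blends \<open>unsplit g h\<close> on the partners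
  \<open>4 * n\<close> and \<open>4 * n + 3\<close>. Both are blends, at the same angle, of one
  value of \<open>g\<close> and one of \<open>h\<close>, so \<open>blend_inverse\<close> recovers
  \<open>g\<close>.\<close>

lemma split1_unsplit:
  fixes g h :: "'a::real_normed_vector lip0"
  shows "split1 (unsplit g h) = g"
proof (rule lip0_eqI)
  fix x :: 'a
  define n where "n = cell x"
  show "lip0_apply (split1 (unsplit g h)) x = lip0_apply g x"
  proof (cases "0 \<le> n")
    case True
    then show ?thesis
      using dil_split1_at(2)[of x 0 n "unsplit g h"]
        dil_unsplit_at(3)[of x "3 * n" n g h] dil_unsplit_at(6)[of x "3 * n + 3" n g h]
      by (simp add: n_def algebra_simps minus_diff_commute blend_inverses)
  next
    case False
    then have "cell x + 0 \<le> -1"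
      unfolding n_def by linarith
    from dil_split1_at(1)[OF this] dil_unsplit_at(1)[OF this] show ?thesis
      by simp
  qed
qed

lemma split2_unsplit:
  fixes g h :: "'a::real_normed_vector lip0"
  shows "split2 (unsplit g h) = h"
proof (rule lip0_eqI)
  fix x :: 'a
  define n where "n = cell x"
  \<comment> \<open>The last four cases are the numbers \<open>- 2 * j\<close> and
    \<open>- 2 * j - 1\<close> with \<open>j = 2 * i\<close>, then with
    \<open>j = 2 * i + 1\<close>. Each uses old cell \<open>1 - 2 * n\<close> and its
    partner.\<close>
  have "1 \<le> n \<or> n = 0 \<or> (\<exists>i\<ge>1. n = - 4 * i) \<or> (\<exists>i\<ge>0. n = - 4 * i - 1)
      \<or> (\<exists>i\<ge>0. n = - 4 * i - 2) \<or> (\<exists>i\<ge>0. n = - 4 * i - 3)"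
    by presburger
  then consider "1 \<le> n" | "n = 0" | i where "n = - 4 * i" "1 \<le> i" | i where "n = - 4 * i - 1" "0 \<le> i"
    | i where "n = - 4 * i - 2" "0 \<le> i" | i where "n = - 4 * i - 3" "0 \<le> i"
    by blast
  then show "lip0_apply (split2 (unsplit g h)) x = lip0_apply h x"
  proof cases
    case 1
    then show ?thesis
      using dil_split2_at(2)[of x 0 n "unsplit g h"]
        dil_unsplit_at(5)[of x "3 * n - 2" "n - 1" g h] dil_unsplit_at(4)[of x "3 * n + 1" n g h]
      by (simp add: n_def algebra_simps blend_inverses)
  next
    case 2
    then show ?thesis
      using dil_split2_at(1)[of x 0 "unsplit g h"] dil_unsplit_at(2)[of x 1 g h] by (simp add: n_def algebra_simps blend_inverses)
  next
    case (3 i)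
    then show ?thesis
      using dil_split2_at(3)[of x 0 "2 * i" "unsplit g h"]
        dil_unsplit_at(4)[of x "12 * i + 1" "2 * i" g h] dil_unsplit_at(5)[of x "12 * i - 2" "2 * i - 1" g h]
      by (simp add: n_def algebra_simps blend_inverses)
  next
    case (4 i)
    then show ?thesis
      using dil_split2_at(4)[of x 0 "2 * i" "unsplit g h"]
        dil_unsplit_at(6)[of x "12 * i + 4" "2 * i" g h] dil_unsplit_at(3)[of x "12 * i + 1" "2 * i" g h]
      by (simp add: n_def algebra_simps blend_inverses)
  next
    case (5 i)
    then show ?thesis
      using dil_split2_at(3)[of x 0 "2 * i + 1" "unsplit g h"]
        dil_unsplit_at(4)[of x "12 * i + 7" "2 * i + 1" g h] dil_unsplit_at(5)[of x "12 * i + 4" "2 * i" g h]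
      by (simp add: n_def algebra_simps blend_inverses)
  next
    case (6 i)
    then show ?thesis
      using dil_split2_at(4)[of x 0 "2 * i + 1" "unsplit g h"]
        dil_unsplit_at(6)[of x "12 * i + 10" "2 * i + 1" g h] dil_unsplit_at(3)[of x "12 * i + 7" "2 * i + 1" g h]
      by (simp add: n_def algebra_simps blend_inverses)
  qed
qed

lemma unsplit_split:
  fixes f :: "'a::real_normed_vector lip0"
  shows "unsplit (split1 f) (split2 f) = f"
proof (rule lip0_eqI)
  fix x :: 'a
  define m where "m = cell x"
  \<comment> \<open>For \<open>m \<ge> 0\<close> the residue modulo 4 determines strand and number;
    cell 1 is separate because the pairing fixes it.\<close>
  have "m \<le> -1 \<or> m = 1 \<or> (\<exists>j\<ge>0. m = 4 * j) \<or> (\<exists>j\<ge>1. m = 4 * j + 1)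
      \<or> (\<exists>j\<ge>0. m = 4 * j + 2) \<or> (\<exists>j\<ge>0. m = 4 * j + 3)"
    by presburger
  then consider "m \<le> -1" | "m = 1" | j where "m = 4 * j" "0 \<le> j" | j where "m = 4 * j + 1" "1 \<le> j"
    | j where "m = 4 * j + 2" "0 \<le> j" | j where "m = 4 * j + 3" "0 \<le> j"
    by blast
  then show "lip0_apply (unsplit (split1 f) (split2 f)) x = lip0_apply f x"
  proof cases
    case 1
    then show ?thesis
      using dil_unsplit_at(1)[of x 0 "split1 f" "split2 f"] dil_split1_at(1)[of x 0 f] by (simp add: m_def algebra_simps blend_inverses)
  next
    case 2
    then show ?thesis
      using dil_unsplit_at(2)[of x 0 "split1 f" "split2 f"] dil_split2_at(1)[of x "-1" f] by (simp add: m_def algebra_simps blend_inverses)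
  next
    case (3 j)
    then show ?thesis
      using dil_unsplit_at(3)[of x 0 j "split1 f" "split2 f"]
        dil_split1_at(2)[of x "- 3 * j" j f] dil_split2_at(4)[of x "- 6 * j - 1" j f]
      by (simp add: m_def algebra_simps blend_inverses)
  next
    case (4 j)
    then show ?thesis
      using dil_unsplit_at(4)[of x 0 j "split1 f" "split2 f"]
        dil_split2_at(3)[of x "- 6 * j - 1" j f] dil_split2_at(2)[of x "- 3 * j - 1" j f]
      by (simp add: m_def algebra_simps blend_inverses)
  next
    case (5 j)
    then show ?thesis
      using dil_unsplit_at(5)[of x 0 j "split1 f" "split2 f"]
        dil_split2_at(2)[of x "- 3 * j - 1" "j + 1" f] dil_split2_at(3)[of x "- 6 * j - 4" "j + 1" f]
      by (simp add: m_def algebra_simps blend_inverses)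
  next
    case (6 j)
    then show ?thesis
      using dil_unsplit_at(6)[of x 0 j "split1 f" "split2 f"]
        dil_split2_at(4)[of x "- 6 * j - 4" j f] dil_split1_at(2)[of x "- 3 * j - 3" j f]
      by (simp add: m_def algebra_simps blend_inverses)
  qed
qed

section \<open>Passage to the free space\<close>

text \<open>A concrete form of weak-star continuity: the adjoint sends evaluations to finite
  combinations of evaluations, hence restricts to the free spaces.\<close>

definition span_represented :: "('a::{metric_space, zero} lip0 \<Rightarrow> 'b::{metric_space, zero} lip0) \<Rightarrow> bool" where
  "span_represented S \<longleftrightarrow>
    (\<forall>x. \<exists>\<mu>\<in>span (range lip_delta). \<forall>f. lip0_apply (S f) x = blinfun_apply \<mu> f)"

lemma span_represented_id: "span_represented (\<lambda>f. f)"
  unfolding span_represented_def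
proof
  fix x
  show "\<exists>\<mu>\<in>span (range lip_delta). \<forall>f. lip0_apply f x = blinfun_apply \<mu> f"
    by (rule bexI[of _ "lip_delta x"]) (auto simp: lip_delta.rep_eq span_base)
qed

lemma span_represented_zero: "span_represented (\<lambda>f. 0)"
  unfolding span_represented_def
proof
  fix x
  show "\<exists>\<mu>\<in>span (range lip_delta). \<forall>f. lip0_apply 0 x = blinfun_apply \<mu> f"
    by (rule bexI[of _ 0]) (auto simp: span_zero)
qed

lemma span_represented_dil:
  assumes "span_represented S"
  shows "span_represented (\<lambda>f. dil a (S f))"
  unfolding span_represented_def
proof
  fix x
  obtain \<mu> where \<mu>: "\<mu> \<in> span (range lip_delta)"
      "\<And>f. lip0_apply (S f) (exp (8 * of_int a) *\<^sub>R x) = blinfun_apply \<mu> f"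
    using assms unfolding span_represented_def by blast
  show "\<exists>\<mu>\<in>span (range lip_delta). \<forall>f. lip0_apply (dil a (S f)) x = blinfun_apply \<mu> f"
    by (rule bexI[of _ "exp (- 8 * of_int a) *\<^sub>R \<mu>"])
      (use \<mu> in \<open>simp_all add: lip0_apply_dil scaleR_blinfun.rep_eq span_scale\<close>)
qed

lemma span_represented_minus:
  assumes "span_represented S"
  shows "span_represented (\<lambda>f. - S f)"
  unfolding span_represented_def
proof
  fix x
  obtain \<mu> where \<mu>: "\<mu> \<in> span (range lip_delta)"
      "\<And>f. lip0_apply (S f) x = blinfun_apply \<mu> f"
    using assms unfolding span_represented_def by blast
  show "\<exists>\<mu>\<in>span (range lip_delta). \<forall>f. lip0_apply (- S f) x = blinfun_apply \<mu> f"
    by (rule bexI[of _ "- \<mu>"]) (use \<mu> in \<open>simp_all add: uminus_blinfun.rep_eq span_neg\<close>)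
qed

text \<open>At a fixed \<open>x\<close> at most two pieces enter, with coefficients that depend on
  \<open>x\<close> but not on \<open>f\<close>.\<close>

lemma span_represented_glue:
  assumes glueable: "\<And>f. glueable P (A f) (C f)" and A: "\<And>k. span_represented (\<lambda>f. A f k)"
  shows "span_represented (\<lambda>f. glue P (A f))"
  unfolding span_represented_def
proof
  fix x
  have "\<exists>\<mu>. \<mu> \<in> span (range lip_delta) \<and> (\<forall>f. lip0_apply (A f k) x = blinfun_apply \<mu> f)" for k
    using A[of k] unfolding span_represented_def by blast
  then obtain \<mu> where \<mu>: "\<And>k. \<mu> k \<in> span (range lip_delta)"
      "\<And>k f. lip0_apply (A f k) x = blinfun_apply (\<mu> k) f"
    by metis
  define u where "u = frac (phase x)"
  define \<nu> where "\<nu> = (if P (cell x)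
    then cos (pi / 2 * u) *\<^sub>R \<mu> (cell x) + sin (pi / 2 * u) *\<^sub>R \<mu> (cell x + 1) else \<mu> (cell x))"
  have "\<nu> \<in> span (range lip_delta)"
    unfolding \<nu>_def using \<mu>(1) by (auto intro!: span_add span_scale)
  moreover have "lip0_apply (glue P (A f)) x = blinfun_apply \<nu> f" for f
    by (simp add: lip0_apply_glue[OF glueable] glue_fun_def \<mu>(2) \<nu>_def u_def blend_def
        plus_blinfun.rep_eq scaleR_blinfun.rep_eq)
  ultimately show "\<exists>\<mu>\<in>span (range lip_delta). \<forall>f. lip0_apply (glue P (A f)) x = blinfun_apply \<mu> f"
    by blast
qed

lemma span_represented_if:
  "span_represented S \<Longrightarrow> span_represented T \<Longrightarrow> span_represented (\<lambda>f. if b then S f else T f)"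
  by (cases b) simp_all

lemmas span_represented_intros = span_represented_if span_represented_dil span_represented_minus
  span_represented_id span_represented_zero

lemma span_represented_split1: "span_represented split1"
  unfolding split1_def[abs_def]
  by (rule span_represented_glue[OF glueable_strand1])
    (unfold strand1_def, intro span_represented_intros)

lemma span_represented_split2: "span_represented split2"
  unfolding split2_def[abs_def]
  by (rule span_represented_glue[OF glueable_strand2])
    (unfold strand2_def, intro span_represented_intros)

lemma span_represented_unsplit_left: "span_represented (\<lambda>g. unsplit g 0)"
  unfolding unsplit_def
  by (rule span_represented_glue[OF glueable_braid])
    (unfold braid_def, intro span_represented_intros)

lemma span_represented_unsplit_right: "span_represented (\<lambda>h. unsplit 0 h)"
  unfolding unsplit_def
  by (rule span_represented_glue[OF glueable_braid])
    (unfold braid_def, intro span_represented_intros)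

section \<open>Linearity and boundedness on Lipschitz functions\<close>

lemma blend_add: "blend u (a + a') (b + b') = blend u a b + blend u a' b'"
  and blend_scale: "blend u (r * a) (r * b) = r * blend u a b"
  by (simp_all add: blend_def algebra_simps)

lemma glue_fun_add: "glue_fun P (\<lambda>k. A k + B k) x = glue_fun P A x + glue_fun P B x"
  and glue_fun_scaleR: "glue_fun P (\<lambda>k. r *\<^sub>R A k) x = r * glue_fun P A x"
  by (simp_all add: glue_fun_def blend_add blend_scale)

lemma bounded_linear_split1: "bounded_linear split1"
proof (rule bounded_linear_intro[where K = 2])
  have "strand1 (f + g) = (\<lambda>k. strand1 f k + strand1 g k)"
    "strand1 (r *\<^sub>R f) = (\<lambda>k. r *\<^sub>R strand1 f k)" for f g :: "'a lip0" and r
    by (simp_all add: strand1_def dil_add dil_scaleR fun_eq_iff)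
  then show "split1 (f + g) = split1 f + split1 g" "split1 (r *\<^sub>R f) = r *\<^sub>R split1 f"
    for f g :: "'a lip0" and r
    by (auto intro!: lip0_eqI simp: lip0_apply_split1 glue_fun_add glue_fun_scaleR)
qed (subst mult.commute, rule norm_split1_le)

lemma bounded_linear_split2: "bounded_linear split2"
proof (rule bounded_linear_intro[where K = 2])
  have "strand2 (f + g) = (\<lambda>k. strand2 f k + strand2 g k)"
    "strand2 (r *\<^sub>R f) = (\<lambda>k. r *\<^sub>R strand2 f k)" for f g :: "'a lip0" and r
    by (simp_all add: strand2_def dil_add dil_scaleR fun_eq_iff)
  then show "split2 (f + g) = split2 f + split2 g" "split2 (r *\<^sub>R f) = r *\<^sub>R split2 f"
    for f g :: "'a lip0" and r
    by (auto intro!: lip0_eqI simp: lip0_apply_split2 glue_fun_add glue_fun_scaleR)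
qed (subst mult.commute, rule norm_split2_le)

lemma unsplit_add: "unsplit (g + g') (h + h') = unsplit g h + unsplit g' h'"
  and unsplit_scaleR: "unsplit (r *\<^sub>R g) (r *\<^sub>R h) = r *\<^sub>R unsplit g h"
proof -
  have "braid (g + g') (h + h') = (\<lambda>k. braid g h k + braid g' h' k)"
    "braid (r *\<^sub>R g) (r *\<^sub>R h) = (\<lambda>k. r *\<^sub>R braid g h k)"
    by (simp_all add: braid_def dil_add dil_scaleR fun_eq_iff)
  then show "unsplit (g + g') (h + h') = unsplit g h + unsplit g' h'"
    "unsplit (r *\<^sub>R g) (r *\<^sub>R h) = r *\<^sub>R unsplit g h"
    by (auto intro!: lip0_eqI simp: lip0_apply_unsplit glue_fun_add glue_fun_scaleR)
qed

lemma bounded_linear_unsplit_left: "bounded_linear (\<lambda>g. unsplit g 0)"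
proof (rule bounded_linear_intro[where K = 2])
  show "unsplit (g + g') 0 = unsplit g 0 + unsplit g' 0" "unsplit (r *\<^sub>R g) 0 = r *\<^sub>R unsplit g 0"
    for g g' :: "'a lip0" and r
    using unsplit_add[of g g' 0 0] unsplit_scaleR[of r g 0] by simp_all
  show "norm (unsplit g 0) \<le> norm g * 2" for g :: "'a lip0"
    using norm_unsplit_le[of g 0] by simp
qed

lemma bounded_linear_unsplit_right: "bounded_linear (\<lambda>h. unsplit 0 h)"
proof (rule bounded_linear_intro[where K = 2])
  show "unsplit 0 (h + h') = unsplit 0 h + unsplit 0 h'" "unsplit 0 (r *\<^sub>R h) = r *\<^sub>R unsplit 0 h"
    for h h' :: "'a lip0" and r
    using unsplit_add[of 0 0 h h'] unsplit_scaleR[of r 0 h] by simp_all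
  show "norm (unsplit 0 h) \<le> norm h * 2" for h :: "'a lip0"
    using norm_unsplit_le[of 0 h] by simp
qed

text \<open>The preadjoint of \<open>S\<close>; it takes values in the free space when \<open>S\<close> is \<open>span_represented\<close>.\<close>

definition preadjoint ::
    "('a::{metric_space, zero} lip0 \<Rightarrow> 'b::{metric_space, zero} lip0) \<Rightarrow> 'b lip_free \<Rightarrow> 'a lip_free" where
  "preadjoint S u = Lip_free (lip_free_functional u o\<^sub>L Blinfun S)"

text \<open>Evaluations go into the span by \<open>rep\<close>, hence so does the span, and by
  continuity its closure goes into the closure. So the composed functional lies where
  \<open>Lip_free\<close> can be inverted.\<close>

lemma preadjoint_apply:
  assumes S: "bounded_linear S" and rep: "span_represented S"
  shows "blinfun_apply (lip_free_functional (preadjoint S u)) f = blinfun_apply (lip_free_functional u) (S f)"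
proof -
  define R where "R \<mu> = \<mu> o\<^sub>L Blinfun S" for \<mu> :: "'b lip0 \<Rightarrow>\<^sub>L real"
  have R: "bounded_linear R"
    unfolding R_def by (rule bounded_bilinear.bounded_linear_left[OF bounded_bilinear_blinfun_compose])
  have "R (lip_delta x) \<in> span (range lip_delta)" for x
  proof -
    obtain \<mu> where \<mu>: "\<mu> \<in> span (range lip_delta)" "\<And>f. lip0_apply (S f) x = blinfun_apply \<mu> f"
      using rep unfolding span_represented_def by blast
    have "R (lip_delta x) = \<mu>"
      by (rule blinfun_eqI) (simp add: R_def bounded_linear_Blinfun_apply[OF S] lip_delta.rep_eq \<mu>(2))
    with \<mu>(1) show ?thesis by simp
  qed
  then have "span (R ` range lip_delta) \<subseteq> span (range lip_delta)"
    by (intro span_minimal subspace_span) auto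
  then have "R ` span (range lip_delta) \<subseteq> span (range lip_delta)"
    by (simp add: linear_span_image[OF bounded_linear.linear[OF R]])
  then have "closure (R ` span (range lip_delta)) \<subseteq> closure (span (range lip_delta))"
    by (rule closure_mono)
  then have "R (lip_free_functional u) \<in> closure (span (range lip_delta))"
    using closure_bounded_linear_image_subset[OF R, of "span (range lip_delta)"] lip_free_functional[of u]
    by blast
  then show ?thesis
    unfolding preadjoint_def R_def
    by (subst Lip_free_inverse) (simp_all add: bounded_linear_Blinfun_apply[OF S])
qed

lemma lip_free_eqI:
  "(\<And>f. blinfun_apply (lip_free_functional u) f = blinfun_apply (lip_free_functional v) f) \<Longrightarrow> u = v"
  by (metis blinfun_eqI lip_free_functional_inject)

lemma norm_lip_free_bound: "\<bar>blinfun_apply (lip_free_functional u) f\<bar> \<le> norm u * norm f"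
  using norm_blinfun[of "lip_free_functional u" f] by (simp add: norm_lip_free.rep_eq)

lemma norm_lip_free_leI:
  "0 \<le> b \<Longrightarrow> (\<And>f. \<bar>blinfun_apply (lip_free_functional u) f\<bar> \<le> b * norm f) \<Longrightarrow> norm u \<le> b"
  unfolding norm_lip_free.rep_eq by (rule norm_blinfun_bound) auto

lemma linear_preadjoint:
  assumes "bounded_linear S" "span_represented S"
  shows "preadjoint S (u + v) = preadjoint S u + preadjoint S v"
    and "preadjoint S (r *\<^sub>R u) = r *\<^sub>R preadjoint S u"
  by (rule lip_free_eqI, simp add: preadjoint_apply[OF assms] plus_lip_free.rep_eq
      scaleR_lip_free.rep_eq plus_blinfun.rep_eq scaleR_blinfun.rep_eq)+

text \<open>The signs of \<open>g\<close> and \<open>h\<close> can be chosen freely, which turns the bound on \<open>u\<close> at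
  \<open>unsplit g h\<close> into a bound on the sum of the absolute values of its two parts.\<close>

lemma norm_preadjoint_unsplit_le:
  "norm (preadjoint (\<lambda>g. unsplit g 0) u) + norm (preadjoint (\<lambda>h. unsplit 0 h) u) \<le> 2 * norm u"
proof -
  let ?u = "blinfun_apply (lip_free_functional u)"
  note left = preadjoint_apply[OF bounded_linear_unsplit_left span_represented_unsplit_left]
  note right = preadjoint_apply[OF bounded_linear_unsplit_right span_represented_unsplit_right]
  have sum: "?u (unsplit g 0) + ?u (unsplit 0 h) = ?u (unsplit g h)" for g h
    using unsplit_add[of g 0 0 h] by (simp add: blinfun.add_right)
  have minus: "?u (unsplit 0 (- h)) = - ?u (unsplit 0 h)" for h
    using unsplit_scaleR[of "-1" 0 h] by (simp add: blinfun.minus_right)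
  have key: "\<bar>?u (unsplit g 0)\<bar> + \<bar>?u (unsplit 0 h)\<bar> \<le> 2 * norm u * max (norm g) (norm h)" for g h
  proof -
    have *: "\<bar>?u (unsplit g h)\<bar> \<le> 2 * norm u * max (norm g) (norm h)" for h
      using norm_lip_free_bound[of u "unsplit g h"]
        mult_left_mono[OF norm_unsplit_le[of g h] norm_ge_zero[of u]] by simp
    show ?thesis
      using *[of h] *[of "- h"] sum[of g h] sum[of g "- h"] minus[of h] by (auto simp: abs_if split: if_splits)
  qed
  \<comment> \<open>Scaling \<open>g\<close> by \<open>norm h\<close> and \<open>h\<close> by
    \<open>norm g\<close> equalizes their norms, so the maximum becomes a product.\<close>
  have scaled: "\<bar>?u (unsplit g 0)\<bar> * norm h + \<bar>?u (unsplit 0 h)\<bar> * norm g \<le> 2 * norm u * (norm g * norm h)" for g h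
  proof -
    have "\<bar>?u (unsplit (norm h *\<^sub>R g) 0)\<bar> + \<bar>?u (unsplit 0 (norm g *\<^sub>R h))\<bar> \<le> 2 * norm u * (norm g * norm h)"
      using key[of "norm h *\<^sub>R g" "norm g *\<^sub>R h"] by (simp add: mult.commute)
    then show ?thesis
      using unsplit_scaleR[of "norm h" g 0] unsplit_scaleR[of "norm g" 0 h]
      by (simp add: blinfun.scaleR_right abs_mult mult.commute)
  qed
  define b where "b = norm (preadjoint (\<lambda>h. unsplit 0 h) u)"
  \<comment> \<open>For fixed \<open>g\<close> the supremum over \<open>h\<close> brings in
    \<open>b\<close>; the supremum over \<open>g\<close> follows.\<close>
  have bg: "\<bar>?u (unsplit g 0)\<bar> \<le> (2 * norm u - b) * norm g" for g
  proof (cases "norm g = 0")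
    case True
    then show ?thesis
      using key[of g 0] by simp
  next
    case False
    then have g: "0 < norm g" by simp
    have "b \<le> 2 * norm u - \<bar>?u (unsplit g 0)\<bar> / norm g"
      unfolding b_def
    proof (rule norm_lip_free_leI)
      show "0 \<le> 2 * norm u - \<bar>?u (unsplit g 0)\<bar> / norm g"
        using key[of g 0] g by (simp add: pos_divide_le_eq)
      fix h
      show "\<bar>blinfun_apply (lip_free_functional (preadjoint (\<lambda>h. unsplit 0 h) u)) h\<bar>
          \<le> (2 * norm u - \<bar>?u (unsplit g 0)\<bar> / norm g) * norm h"
        using scaled[of g h] g by (simp add: right field_simps)
    qed
    then show ?thesis
      using g by (simp add: field_simps)
  qed
  \<comment> \<open>This provides the nonnegative bound that \<open>norm_lip_free_leI\<close> asks
    for.\<close>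
  have "b \<le> 2 * norm u"
    unfolding b_def
  proof (rule norm_lip_free_leI)
    show "\<bar>blinfun_apply (lip_free_functional (preadjoint (\<lambda>h. unsplit 0 h) u)) h\<bar> \<le> 2 * norm u * norm h" for h
      using key[of 0 h] by (simp add: right)
  qed simp
  then have "norm (preadjoint (\<lambda>g. unsplit g 0) u) \<le> 2 * norm u - b"
    by (intro norm_lip_free_leI) (simp_all add: left bg)
  then show ?thesis
    by (simp add: b_def)
qed

lemma norm_preadjoint_le:
  assumes "bounded_linear S" "span_represented S" "\<And>f. norm (S f) \<le> b * norm f" "0 \<le> b"
  shows "norm (preadjoint S u) \<le> b * norm u"
proof (rule norm_lip_free_leI)
  fix f
  show "\<bar>blinfun_apply (lip_free_functional (preadjoint S u)) f\<bar> \<le> b * norm u * norm f"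
    using norm_lip_free_bound[of u "S f"] mult_left_mono[OF assms(3)[of f] norm_ge_zero[of u]]
    by (simp add: preadjoint_apply[OF assms(1,2)] mult_ac)
qed (simp add: assms(4))

section \<open>The isomorphism of free spaces\<close>

text \<open>The dual of the l1-sum consists of pairs \<open>(g, h)\<close> under the maximum norm;
  this is the preadjoint of \<open>unsplit\<close> on such pairs, and \<open>undouble\<close> that
  of \<open>f\<close> mapped to \<open>(split1 f, split2 f)\<close>.\<close>

definition double :: "'a::real_normed_vector lip_free \<Rightarrow> ('a lip_free, 'a lip_free) l1_sum" where
  "double u = L1_pair (preadjoint (\<lambda>g. unsplit g 0) u, preadjoint (\<lambda>h. unsplit 0 h) u)"

definition undouble :: "('a::real_normed_vector lip_free, 'a lip_free) l1_sum \<Rightarrow> 'a lip_free" where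
  "undouble p = preadjoint split1 (fst (l1_pair p)) + preadjoint split2 (snd (l1_pair p))"

lemmas preadjoint_applies =
  preadjoint_apply[OF bounded_linear_split1 span_represented_split1]
  preadjoint_apply[OF bounded_linear_split2 span_represented_split2]
  preadjoint_apply[OF bounded_linear_unsplit_left span_represented_unsplit_left]
  preadjoint_apply[OF bounded_linear_unsplit_right span_represented_unsplit_right]

lemmas linear_preadjoints =
  linear_preadjoint[OF bounded_linear_split1 span_represented_split1]
  linear_preadjoint[OF bounded_linear_split2 span_represented_split2]
  linear_preadjoint[OF bounded_linear_unsplit_left span_represented_unsplit_left]
  linear_preadjoint[OF bounded_linear_unsplit_right span_represented_unsplit_right]

text \<open>Preadjoints reverse composition, so tested on \<open>f\<close> this is
  \<open>unsplit_split\<close>.\<close>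

lemma undouble_double:
  fixes u :: "'a::real_normed_vector lip_free"
  shows "undouble (double u) = u"
proof (rule lip_free_eqI)
  fix f :: "'a lip0"
  have "unsplit (split1 f) 0 + unsplit 0 (split2 f) = f"
    using unsplit_add[of "split1 f" 0 0 "split2 f"] by (simp add: unsplit_split)
  then show "blinfun_apply (lip_free_functional (undouble (double u))) f = blinfun_apply (lip_free_functional u) f"
    by (simp add: undouble_def double_def L1_pair_inverse plus_lip_free.rep_eq plus_blinfun.rep_eq
        preadjoint_applies flip: blinfun.add_right)
qed

lemma double_undouble:
  fixes p :: "('a::real_normed_vector lip_free, 'a lip_free) l1_sum"
  shows "double (undouble p) = p"
proof -
  have *: "split1 (unsplit g 0) = g" "split2 (unsplit g 0) = 0"
    "split1 (unsplit 0 h) = 0" "split2 (unsplit 0 h) = h" for g h :: "'a lip0"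
    by (simp_all add: split1_unsplit split2_unsplit)
  have "preadjoint (\<lambda>g. unsplit g 0) (undouble p) = fst (l1_pair p)"
    "preadjoint (\<lambda>h. unsplit 0 h) (undouble p) = snd (l1_pair p)"
    by (rule lip_free_eqI, simp add: undouble_def plus_lip_free.rep_eq plus_blinfun.rep_eq preadjoint_applies *)+
  then show ?thesis
    by (simp add: double_def l1_pair_inverse)
qed

lemma norm_double_le: "norm (double u) \<le> 2 * norm u"
  by (simp add: double_def norm_l1_sum.rep_eq L1_pair_inverse norm_preadjoint_unsplit_le)

lemma norm_undouble_le: "norm (undouble p) \<le> 2 * norm p"
proof -
  have "norm (undouble p) \<le> 2 * norm (fst (l1_pair p)) + 2 * norm (snd (l1_pair p))"
    unfolding undouble_def
    by (intro order_trans[OF norm_triangle_ineq] add_mono norm_preadjoint_le norm_split1_le norm_split2_le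
        bounded_linear_split1 bounded_linear_split2 span_represented_split1 span_represented_split2) auto
  then show ?thesis
    by (simp add: norm_l1_sum.rep_eq split_beta)
qed

lemma bounded_linear_double: "bounded_linear double"
proof (rule bounded_linear_intro[where K = 2])
  show "double (u + v) = double u + double v" for u v :: "'a lip_free"
    by (simp add: double_def linear_preadjoints plus_l1_sum.abs_eq)
  show "double (r *\<^sub>R u) = r *\<^sub>R double u" for r and u :: "'a lip_free"
    by (simp add: double_def linear_preadjoints scaleR_l1_sum.abs_eq)
qed (subst mult.commute, rule norm_double_le)

lemma bounded_linear_undouble: "bounded_linear undouble"
proof (rule bounded_linear_intro[where K = 2])
  show "undouble (p + q) = undouble p + undouble q" for p q :: "('a lip_free, 'a lip_free) l1_sum"
    by (simp add: undouble_def linear_preadjoints plus_l1_sum.rep_eq)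
  show "undouble (r *\<^sub>R p) = r *\<^sub>R undouble p" for r and p :: "('a lip_free, 'a lip_free) l1_sum"
    by (simp add: undouble_def linear_preadjoints scaleR_l1_sum.rep_eq scaleR_add_right)
qed (subst mult.commute, rule norm_undouble_le)

theorem proposition4p6:
  shows "banach_mazur_dist TYPE('a::banach lip_free) TYPE(('a lip_free, 'a lip_free) l1_sum) \<le> 4"
proof -
  let ?T = "double :: 'a lip_free \<Rightarrow> _"
  have bij: "bij ?T"
    by (rule bij_betw_byWitness[where f' = undouble]) (auto simp: undouble_double double_undouble)
  have inv: "inv ?T = undouble"
    by (rule inv_unique_comp) (auto simp: fun_eq_iff undouble_double double_undouble)
  \<comment> \<open>Each factor 2 is the cost of a gluing in \<open>norm_glue_le\<close>.\<close>
  have "onorm ?T * onorm (inv ?T) \<le> 2 * 2"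
    unfolding inv
    by (intro mult_mono onorm_bound norm_double_le norm_undouble_le onorm_pos_le bounded_linear_undouble) auto
  then have "ennreal (onorm ?T * onorm (inv ?T)) \<le> 4"
    using ennreal_leI[of _ 4] by simp
  then show ?thesis
    unfolding banach_mazur_dist_def
    by (intro INF_lower2[of ?T]) (auto simp: bij inv bounded_linear_double bounded_linear_undouble)
qed

end
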